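(* Let $\Omega\subset\mathbb R^n$ ($n\ge 2$) be a domain, let $s\ge 2$, let $f\in C^s(\Omega,\mathbb R)$ be such that $\nabla f(x)\neq 0$ at every point of $\Gamma=\{x\in\Omega: f(x)=0\}$, let $\vec V\in C^s(\Omega,\mathbb R^n)$, let $r>0$ be real, and let $\vec W=f^{-r}\vec V$ on $\Omega\setminus\Gamma$. Then: (1) One has $\lim_{x\to x_*} f^{r+1}(x)D_{\vec W}(x)=0$ for all $x_*\in\Gamma$ if and only if $\Gamma$ is an invariant hypersurface of $\vec V$. (2) The function $f$ is a first integral of $\vec V$ if and only if $f^rD_{\vec W}(x)\equiv D_{\vec V}(x)$. (3) Assume that $f$ is a first integral of $\vec V$ and that for every $x_*\in\Gamma$ with $\vec V(x_* )=0$ and every $i=1,\dots,n$ $$\lim_{x\to x_*} f^r(x)D_{\vec W}(x)=0,\qquad \lim_{x\to x_*} f^{r+1}(x)\frac{\partial D_{\vec W}}{\partial x_i}(x)=0 .$$ Then $D_{\vec V}(x_* )=0$ for every $x_*\in\Gamma$ such that $\vec V(x_* )=0$.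
   Context: $D_{\vec X}$ denotes the divergence (in the Cartesian coordinates $x_1,\dots,x_n$) of a vector field $\vec X$, and $L_{\vec X}$ the Lie derivative along $\vec X$. The function $D_{\vec W}$ is defined on $\Omega\setminus\Gamma$; limits as $x\to x_*\in\Gamma$ are taken over $x\in\Omega\setminus\Gamma$, and the identity $f^rD_{\vec W}\equiv D_{\vec V}$ is understood on $\Omega\setminus\Gamma$ (with $f^rD_{\vec W}$ extended to $\Gamma$ by continuity). $\Gamma$ is an invariant hypersurface of $\vec V$ if $\vec V$ is tangent to $\Gamma$, i.e. $L_{\vec V}f|_\Gamma=0$. $f$ is a first integral of $\vec V$ if $L_{\vec V}f\equiv 0$ on $\Omega$. For non-integer $r$, real powers of $f$ on the set $\{f<0\}$ are understood via one fixed continuous branch $f^a=e^{a\log f}$ (possibly complex-valued), so that $f^{a+b}=f^af^b$ and $\partial_{x_i}f^a=af^{a-1}\partial_{x_i}f$. *)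

theory Defs
  imports "HOL-Analysis.Analysis"
begin

definition partial_deriv :: "'n::finite \<Rightarrow> (real^'n \<Rightarrow> 'b::real_normed_vector) \<Rightarrow> real^'n \<Rightarrow> 'b"
  where "partial_deriv i g x = vector_derivative (\<lambda>t. g (x + t *\<^sub>R axis i 1)) (at 0)"

text \<open>The class \<open>C\<^sup>k\<close> on an open set \<open>S\<close>. At each order below \<open>k\<close> differentiability is required
  explicitly, so that the total function \<^const>\<open>partial_deriv\<close> is the actual partial derivative.\<close>

fun C_k_on :: "nat \<Rightarrow> (real^'n) set \<Rightarrow> (real^'n::finite \<Rightarrow> 'b::real_normed_vector) \<Rightarrow> bool"
  where
    "C_k_on 0 S g \<longleftrightarrow> continuous_on S g"
  | "C_k_on (Suc k) S g \<longleftrightarrow>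
       (\<forall>x\<in>S. g differentiable (at x)) \<and> (\<forall>i. C_k_on k S (partial_deriv i g))"

definition grad :: "(real^'n::finite \<Rightarrow> real) \<Rightarrow> real^'n \<Rightarrow> real^'n"
  where "grad f x = (\<chi> i. partial_deriv i f x)"

text \<open>The components may be real or complex: fractional powers of a negative function
  lead to complex vector fields on a real domain.\<close>

definition divergence :: "(real^'n::finite \<Rightarrow> 'b::real_normed_vector^'n) \<Rightarrow> real^'n \<Rightarrow> 'b"
  where "divergence X x = (\<Sum>i\<in>UNIV. partial_deriv i (\<lambda>y. X y $ i) x)"

definition lie_deriv :: "(real^'n::finite \<Rightarrow> real^'n) \<Rightarrow> (real^'n \<Rightarrow> real) \<Rightarrow> real^'n \<Rightarrow> real"
  where "lie_deriv X f x = (\<Sum>i\<in>UNIV. X x $ i * partial_deriv i f x)"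

definition first_integral_on ::
  "(real^'n) set \<Rightarrow> (real^'n::finite \<Rightarrow> real^'n) \<Rightarrow> (real^'n \<Rightarrow> real) \<Rightarrow> bool"
  where "first_integral_on S X f \<longleftrightarrow> (\<forall>x\<in>S. lie_deriv X f x = 0)"

text \<open>Invariance of the zero set of \<open>f\<close> in \<open>S\<close>, a hypersurface if \<open>grad f\<close> does not vanish on it,
  in the sense that \<open>X\<close> is tangent to it.\<close>

definition invariant_zero_set ::
  "(real^'n) set \<Rightarrow> (real^'n::finite \<Rightarrow> real^'n) \<Rightarrow> (real^'n \<Rightarrow> real) \<Rightarrow> bool"
  where "invariant_zero_set S X f \<longleftrightarrow> (\<forall>x\<in>{x\<in>S. f x = 0}. lie_deriv X f x = 0)"

text \<open>\<open>l\<close> is a continuous branch of \<open>log f\<close> on \<open>S\<close>, real-valued where \<open>f\<close> is positive; where \<open>f\<close> is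
  negative it is \<open>ln \<bar>f\<bar>\<close> plus an odd multiple of \<open>\<i> \<pi>\<close>, locally constant.\<close>

definition log_branch_on ::
  "'a::topological_space set \<Rightarrow> ('a \<Rightarrow> real) \<Rightarrow> ('a \<Rightarrow> complex) \<Rightarrow> bool"
  where "log_branch_on S f l \<longleftrightarrow> continuous_on S l \<and>
    (\<forall>x\<in>S. exp (l x) = of_real (f x)) \<and> (\<forall>x\<in>S. f x > 0 \<longrightarrow> l x = of_real (ln (f x)))"

text \<open>The real power \<open>f\<^sup>a\<close> determined by the branch \<open>l\<close> of \<open>log f\<close>. For \<open>f x > 0\<close> it is
  \<open>f x powr a\<close>, and for integer \<open>a\<close> it does not depend on the branch.\<close>

definition branch_power :: "('a \<Rightarrow> complex) \<Rightarrow> real \<Rightarrow> 'a \<Rightarrow> complex"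
  where "branch_power l a x = exp (of_real a * l x)"

end

theory Submission
  imports Defs
begin

text \<open>Off \<open>\<Gamma>\<close> the product rule gives \<open>f\<^sup>r D\<^sub>W = D\<^sub>V - r L\<^sub>V f / f\<close>, hence
  \<open>f\<^sup>r\<^sup>+\<^sup>1 D\<^sub>W = f D\<^sub>V - r L\<^sub>V f\<close>. The functions \<open>D\<^sub>V\<close> and \<open>L\<^sub>V f\<close> are continuous on \<open>\<Omega>\<close>, and
  since \<open>grad f\<close> does not vanish on \<open>\<Gamma>\<close>, every point of \<open>\<Gamma>\<close> is a limit point of \<open>\<Omega> - \<Gamma>\<close>.
  All three claims follow by passing to the limit; for (3), \<open>f\<^sup>r D\<^sub>W = D\<^sub>V\<close> when \<open>f\<close> is a
  first integral.\<close>

section \<open>Partial derivatives and continuity of first-order expressions\<close>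

lemma partial_deriv_eq:
  assumes "(g has_derivative D) (at x)"
  shows "partial_deriv i g x = D (axis i 1)"
proof -
  have "((\<lambda>t::real. x + t *\<^sub>R axis i 1) has_derivative (\<lambda>t. t *\<^sub>R axis i 1)) (at 0)"
    by (auto intro!: derivative_eq_intros)
  moreover have "(g has_derivative D) (at (x + 0 *\<^sub>R axis i 1))"
    using assms by simp
  ultimately have "((\<lambda>t. g (x + t *\<^sub>R axis i 1)) has_derivative (\<lambda>t. D (t *\<^sub>R axis i 1))) (at 0)"
    by (rule has_derivative_compose)
  moreover have "D (t *\<^sub>R axis i 1) = t *\<^sub>R D (axis i 1)" for t
    using assms by (simp add: has_derivative_bounded_linear linear_simps)
  ultimately show ?thesis
    unfolding partial_deriv_def by (simp add: has_vector_derivative_def vector_derivative_at)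
qed

text \<open>Bridges two conventions: \<open>C_k_on\<close> differentiates the vector field as a
  whole, \<open>divergence\<close> differentiates its components.\<close>

lemma partial_deriv_component:
  assumes "V differentiable (at x)"
  shows "partial_deriv i (\<lambda>y. V y $ j) x = partial_deriv i V x $ j"
proof -
  obtain D where D: "(V has_derivative D) (at x)"
    using assms by (auto simp: differentiable_def)
  show ?thesis
    using partial_deriv_eq[OF D] partial_deriv_eq[OF bounded_linear.has_derivative[OF bounded_linear_vec_nth D]] by simp
qed

lemma C_k_on_differentiable:
  "C_k_on s S g \<Longrightarrow> s \<ge> 1 \<Longrightarrow> x \<in> S \<Longrightarrow> g differentiable (at x)"
  by (cases s) auto

lemma C_k_on_isCont_partial_deriv:
  assumes "C_k_on s S g" "s \<ge> 2" "x \<in> S"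
  shows "isCont (partial_deriv i g) x"
proof -
  obtain k where "s = Suc (Suc k)"
    using \<open>s \<ge> 2\<close> by (metis add_2_eq_Suc le_Suc_ex)
  with assms have "partial_deriv i g differentiable (at x)" by simp
  then show ?thesis by (rule differentiable_imp_continuous_within)
qed

lemma isCont_divergence:
  assumes "open S" "C_k_on s S V" "s \<ge> 2" "x \<in> S"
  shows "isCont (divergence V) x"
proof -
  have "isCont (\<lambda>y. \<Sum>i\<in>UNIV. partial_deriv i V y $ i) x"
    using C_k_on_isCont_partial_deriv[OF assms(2-4)] by (intro continuous_intros)
  \<comment> \<open>Componentwise differentiation is justified only at points of \<open>S\<close>,
    so the two expressions are compared on a neighbourhood of \<open>x\<close>.\<close>
  moreover have "\<forall>\<^sub>F y in nhds x. divergence V y = (\<Sum>i\<in>UNIV. partial_deriv i V y $ i)"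
    using eventually_nhds_in_open[OF \<open>open S\<close> \<open>x \<in> S\<close>]
    by eventually_elim
      (use assms(2,3) in \<open>auto simp: divergence_def intro!: sum.cong partial_deriv_component
         intro: C_k_on_differentiable\<close>)
  ultimately show ?thesis by (simp add: isCont_cong)
qed

lemma isCont_lie_deriv:
  assumes "C_k_on s S V" "C_k_on s S f" "s \<ge> 2" "x \<in> S"
  shows "isCont (lie_deriv V f) x"
proof -
  have "isCont V x"
    using C_k_on_differentiable[OF assms(1)] assms(3,4)
    by (intro differentiable_imp_continuous_within) auto
  then show ?thesis
    unfolding lie_deriv_def using C_k_on_isCont_partial_deriv[OF assms(2-4)]
    by (intro continuous_intros)
qed

section \<open>Approach to the zero set and branches of the logarithm\<close>

text \<open>Otherwise \<open>f\<close> would vanish on a whole neighbourhood of \<open>a\<close>,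
  forcing a zero derivative there. This is what makes limits at points of the hypersurface
  unique.\<close>

lemma not_trivial_limit_off_zero_set:
  assumes "open S" "a \<in> S" "f differentiable (at a)" "f a = 0" "grad f a \<noteq> 0"
  shows "at a within S - {x\<in>S. f x = 0} \<noteq> bot"
proof
  assume "at a within S - {x\<in>S. f x = 0} = bot"
  then have "\<forall>\<^sub>F y in at a. y \<notin> S - {x\<in>S. f x = 0}"
    by (simp add: eventually_at_filter flip: eventually_False)
  moreover have "\<forall>\<^sub>F y in at a. y \<in> S"
    using assms(1,2) by (rule eventually_at_in_open')
  ultimately have ev: "\<forall>\<^sub>F y in at a. f y = 0"
    by eventually_elim auto
  obtain D where D: "(f has_derivative D) (at a)"
    using assms(3) by (auto simp: differentiable_def)
  have "((\<lambda>_. 0) has_derivative D) (at a)"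
    using has_derivative_transform_eventually[OF D ev] \<open>f a = 0\<close> by simp
  then have "D = (\<lambda>_. 0)"
    using has_derivative_unique has_derivative_const by blast
  with assms(5) show False
    by (simp add: grad_def partial_deriv_eq[OF D] vec_eq_iff)
qed

text \<open>Near \<open>x\<close> the branch is \<open>l x + ln (f y / f x)\<close>: the exponentials agree, and continuity keeps
  \<open>l y - l x\<close> in the strip on which \<open>Ln\<close> inverts \<open>exp\<close>.\<close>

lemma has_derivative_log_branch:
  assumes "open S" "x \<in> S" "log_branch_on S f l" "(f has_derivative D) (at x)"
  shows "(l has_derivative (\<lambda>h. of_real (D h / f x))) (at x)"
proof -
  have cont: "isCont l x" and ex: "\<And>y. y \<in> S \<Longrightarrow> exp (l y) = of_real (f y)"
    using assms by (auto simp: log_branch_on_def continuous_on_eq_continuous_at)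
  have fx: "f x \<noteq> 0"
    using ex[OF \<open>x \<in> S\<close>] by (metis exp_not_eq_zero of_real_0)
  have "isCont f x"
    using assms(4) has_derivative_continuous by blast
  then have "((\<lambda>y. f y / f x) \<longlongrightarrow> f x / f x) (at x)"
    using fx by (intro tendsto_intros) (auto simp: isCont_def)
  \<comment> \<open>Positivity of the quotient, which holds near \<open>x\<close> for either sign of
    \<open>f x\<close>, turns \<open>Ln\<close> into the real \<open>ln\<close>.\<close>
  then have "\<forall>\<^sub>F y in at x. f y / f x > 0"
    using fx by (intro order_tendstoD(1)) auto
  moreover have "((\<lambda>y. l y - l x) \<longlongrightarrow> l x - l x) (at x)"
    using cont by (intro tendsto_intros) (auto simp: isCont_def)
  then have "\<forall>\<^sub>F y in at x. norm (l y - l x) < pi"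
    by (intro order_tendstoD(2)[OF tendsto_norm]) auto
  moreover have "\<forall>\<^sub>F y in at x. y \<in> S"
    using assms(1,2) by (rule eventually_at_in_open')
  ultimately have ev: "\<forall>\<^sub>F y in at x. l x + of_real (ln (f y / f x)) = l y"
  proof eventually_elim
    case (elim y)
    have "\<bar>Im (l y - l x)\<bar> < pi"
      using elim(2) abs_Im_le_cmod[of "l y - l x"] by linarith
    then have "l y - l x = Ln (exp (l y - l x))"
      by (intro Ln_exp[symmetric]) auto
    also have "exp (l y - l x) = of_real (f y / f x)"
      using elim(3) \<open>x \<in> S\<close> by (simp add: exp_diff ex)
    also have "Ln (of_real (f y / f x)) = of_real (ln (f y / f x))"
      using elim(1) by (rule Ln_of_real)
    finally show ?case by (simp add: algebra_simps)
  qed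
  have "((\<lambda>y. l x + of_real (ln (f y / f x))) has_derivative (\<lambda>h. of_real (D h / f x))) (at x)"
    using fx by (auto intro!: derivative_eq_intros assms(4))
  from has_derivative_transform_eventually[OF this ev] fx show ?thesis by simp
qed

section \<open>Divergence of a field scaled by a real power\<close>

text \<open>Product rule: div (g V) = g div V + V . grad g, where g is the power of \<open>f\<close>
  with exponent \<open>c\<close> and grad g = c g (grad f) / f. The theorem uses it with
  \<open>c\<close> equal to \<open>- r\<close>.\<close>

lemma divergence_branch_power_scale:
  fixes V :: "real^'n::finite \<Rightarrow> real^'n"
  assumes "open S" "x \<in> S" "log_branch_on S f l"
    and "f differentiable (at x)" "V differentiable (at x)"
    and W: "\<forall>y\<in>S. W y = (\<chi> i. branch_power l c y * of_real (V y $ i))"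
  shows "divergence W x =
    branch_power l c x * of_real (divergence V x + c * lie_deriv V f x / f x)"
proof -
  obtain D where D: "(f has_derivative D) (at x)"
    using assms(4) by (auto simp: differentiable_def)
  obtain E where E: "(V has_derivative E) (at x)"
    using assms(5) by (auto simp: differentiable_def)
  note l = has_derivative_log_branch[OF assms(1-3) D]
  have "partial_deriv i (\<lambda>y. W y $ i) x = branch_power l c x *
    of_real (partial_deriv i (\<lambda>y. V y $ i) x + c * (V x $ i * partial_deriv i f x) / f x)" for i
  proof -
    have Vi: "((\<lambda>y. V y $ i) has_derivative (\<lambda>h. E h $ i)) (at x)"
      by (rule bounded_linear.has_derivative[OF bounded_linear_vec_nth E])
    have "((\<lambda>y. exp (of_real c * l y)) has_derivative
        (\<lambda>h. exp (of_real c * l x) * (of_real c * of_real (D h / f x)))) (at x)"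
      by (rule has_derivative_compose[OF has_derivative_mult_right[OF l]
            DERIV_exp[unfolded has_field_derivative_def]])
    from has_derivative_mult[OF this has_derivative_of_real[OF Vi]]
    have d: "((\<lambda>y. exp (of_real c * l y) * of_real (V y $ i)) has_derivative
      (\<lambda>h. exp (of_real c * l x) * of_real (E h $ i + c * (V x $ i * D h) / f x))) (at x)"
      by (simp add: algebra_simps)
    \<comment> \<open>\<open>W\<close> is prescribed only on \<open>S\<close>; openness of
      \<open>S\<close> carries the derivative over from the explicit product.\<close>
    have "\<forall>\<^sub>F y in at x. y \<in> S"
      using assms(1,2) by (rule eventually_at_in_open')
    then have "\<forall>\<^sub>F y in at x. exp (of_real c * l y) * of_real (V y $ i) = W y $ i"
      by eventually_elim (simp add: W branch_power_def)
    from has_derivative_transform_eventually[OF d this] assms(2)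
    have "((\<lambda>y. W y $ i) has_derivative
      (\<lambda>h. exp (of_real c * l x) * of_real (E h $ i + c * (V x $ i * D h) / f x))) (at x)"
      by (simp add: W branch_power_def)
    from partial_deriv_eq[OF this] show ?thesis
      by (simp add: partial_deriv_eq[OF D] partial_deriv_eq[OF Vi] branch_power_def)
  qed
  then have "divergence W x = branch_power l c x * of_real (\<Sum>i\<in>UNIV.
      partial_deriv i (\<lambda>y. V y $ i) x + c * (V x $ i * partial_deriv i f x) / f x)"
    unfolding divergence_def by (simp only: sum_distrib_left of_real_sum)
  also have "(\<Sum>i\<in>UNIV. partial_deriv i (\<lambda>y. V y $ i) x + c * (V x $ i * partial_deriv i f x) / f x) =
      divergence V x + c * lie_deriv V f x / f x"
    by (simp add: divergence_def lie_deriv_def sum.distrib sum_distrib_left sum_divide_distrib)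
  finally show ?thesis .
qed

section \<open>Limits at \<Gamma> and the three claims\<close>

theorem theorem1:
  fixes \<Omega> \<Gamma> :: "(real^'n::finite) set"
    and f :: "real^'n \<Rightarrow> real"
    and V :: "real^'n \<Rightarrow> real^'n"
    and W :: "real^'n \<Rightarrow> complex^'n"
    and l :: "real^'n \<Rightarrow> complex"
    and r :: real
    and s :: nat
  assumes "CARD('n) \<ge> 2"
    and "open \<Omega>" and "connected \<Omega>" and "\<Omega> \<noteq> {}"
    and "s \<ge> 2"
    and "C_k_on s \<Omega> f"
    and "\<Gamma> = {x\<in>\<Omega>. f x = 0}"
    and "\<forall>x\<in>\<Gamma>. grad f x \<noteq> 0"
    and "C_k_on s \<Omega> V"
    and "r > 0"
    and "log_branch_on (\<Omega> - \<Gamma>) f l"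
    and "\<forall>x\<in>\<Omega> - \<Gamma>. W x = (\<chi> i. branch_power l (- r) x * of_real (V x $ i))"
  shows "((\<forall>a\<in>\<Gamma>. ((\<lambda>x. branch_power l (r + 1) x * divergence W x) \<longlongrightarrow> 0) (at a within \<Omega> - \<Gamma>))
            \<longleftrightarrow> invariant_zero_set \<Omega> V f)
       \<and> (first_integral_on \<Omega> V f \<longleftrightarrow>
            (\<forall>x\<in>\<Omega> - \<Gamma>. branch_power l r x * divergence W x = of_real (divergence V x)) \<and>
            (\<forall>a\<in>\<Gamma>. ((\<lambda>x. branch_power l r x * divergence W x)
                       \<longlongrightarrow> of_real (divergence V a)) (at a within \<Omega> - \<Gamma>)))
       \<and> (first_integral_on \<Omega> V f \<and>
            (\<forall>a\<in>\<Gamma>. V a = 0 \<longrightarrow> (\<forall>i.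
               ((\<lambda>x. branch_power l r x * divergence W x) \<longlongrightarrow> 0) (at a within \<Omega> - \<Gamma>) \<and>
               ((\<lambda>x. branch_power l (r + 1) x * partial_deriv i (divergence W) x) \<longlongrightarrow> 0)
                 (at a within \<Omega> - \<Gamma>)))
            \<longrightarrow> (\<forall>a\<in>\<Gamma>. V a = 0 \<longrightarrow> divergence V a = 0))"
proof -
  note open_\<Omega> = \<open>open \<Omega>\<close> and \<Gamma> = \<open>\<Gamma> = {x\<in>\<Omega>. f x = 0}\<close> and s = \<open>s \<ge> 2\<close>
    and Cf = \<open>C_k_on s \<Omega> f\<close> and CV = \<open>C_k_on s \<Omega> V\<close> and r = \<open>r > 0\<close>
    and l = \<open>log_branch_on (\<Omega> - \<Gamma>) f l\<close>
    and W = \<open>\<forall>x\<in>\<Omega> - \<Gamma>. W x = (\<chi> i. branch_power l (- r) x * of_real (V x $ i))\<close>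
  define F where "F a = at a within \<Omega> - \<Gamma>" for a
  have f_diff: "f differentiable (at x)" and V_diff: "V differentiable (at x)" if "x \<in> \<Omega>" for x
    using that s by (auto intro: C_k_on_differentiable[OF Cf] C_k_on_differentiable[OF CV])
  have f_cont: "isCont f x" if "x \<in> \<Omega>" for x
    using f_diff[OF that] by (rule differentiable_imp_continuous_within)
  \<comment> \<open>Differentiating \<open>W\<close> requires a full neighbourhood on which its
    formula holds.\<close>
  have "open (\<Omega> - \<Gamma>)"
  proof -
    have "continuous_on \<Omega> f"
      using f_cont by (simp add: continuous_at_imp_continuous_on)
    then have "open (\<Omega> \<inter> f -` (- {0}))"
      using open_\<Omega> by (intro continuous_open_preimage) auto
    moreover have "\<Omega> \<inter> f -` (- {0}) = \<Omega> - \<Gamma>"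
      using \<Gamma> by auto
    ultimately show ?thesis by simp
  qed
  note div_W = divergence_branch_power_scale[OF this _ l f_diff V_diff W]
  have eq_r: "branch_power l r x * divergence W x =
      of_real (divergence V x - r * lie_deriv V f x / f x)" if "x \<in> \<Omega> - \<Gamma>" for x
  proof -
    \<comment> \<open>The opposite exponents cancel, so the product with
      \<open>divergence W x\<close> is real and independent of the branch.\<close>
    have "branch_power l r x * branch_power l (- r) x = 1"
      by (simp add: branch_power_def flip: exp_add)
    with div_W[of x] that show ?thesis
      by (simp flip: mult.assoc)
  qed
  have eq_r1: "branch_power l (r + 1) x * divergence W x =
      of_real (f x * divergence V x - r * lie_deriv V f x)" if "x \<in> \<Omega> - \<Gamma>" for x
  proof -
    have fx: "f x \<noteq> 0"
      using that \<Gamma> by auto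
    \<comment> \<open>The extra factor is \<open>exp (l x)\<close>, which equals \<open>f x\<close>
      by the definition of a branch; it clears the denominator in \<open>eq_r\<close>.\<close>
    have "branch_power l (r + 1) x = of_real (f x) * branch_power l r x"
      using l that by (simp add: branch_power_def log_branch_on_def exp_add ring_distribs)
    then have "branch_power l (r + 1) x * divergence W x =
        of_real (f x * (divergence V x - r * lie_deriv V f x / f x))"
      using eq_r[OF that] by simp
    with fx show ?thesis by (simp add: right_diff_distrib)
  qed
  have F_ev: "\<forall>\<^sub>F x in F a. x \<in> \<Omega> - \<Gamma>" for a
    by (simp add: F_def eventually_at_filter)
  have F_ne: "F a \<noteq> bot" and a_\<Omega>: "a \<in> \<Omega>" and fa: "f a = 0" if "a \<in> \<Gamma>" for a
    using that not_trivial_limit_off_zero_set[OF open_\<Omega> _ f_diff, of a] \<Gamma>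
      \<open>\<forall>x\<in>\<Gamma>. grad f x \<noteq> 0\<close> by (auto simp: F_def)
  have F_lim: "(g \<longlongrightarrow> g a) (F a)" if "isCont g a" for g :: "real^'n \<Rightarrow> real" and a
    using that by (simp add: F_def isCont_def Lim_at_imp_Lim_at_within)
  have div_lim: "(divergence V \<longlongrightarrow> divergence V a) (F a)"
    and lie_lim: "(lie_deriv V f \<longlongrightarrow> lie_deriv V f a) (F a)" if "a \<in> \<Omega>" for a
    using that isCont_divergence[OF open_\<Omega> CV s] isCont_lie_deriv[OF CV Cf s]
    by (auto intro: F_lim)
  \<comment> \<open>For a first integral the Lie term in \<open>eq_r\<close> vanishes. The resulting
    limit gives the continuous extension in (2) and the comparison in (3).\<close>
  have r_lim: "((\<lambda>x. branch_power l r x * divergence W x) \<longlongrightarrow> of_real (divergence V a)) (F a)"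
    if "first_integral_on \<Omega> V f" "a \<in> \<Omega>" for a
  proof (rule Lim_transform_eventually[OF tendsto_of_real[OF div_lim[OF \<open>a \<in> \<Omega>\<close>]]])
    show "\<forall>\<^sub>F x in F a. of_real (divergence V x) = branch_power l r x * divergence W x"
      using F_ev by eventually_elim (use that in \<open>auto simp: eq_r first_integral_on_def\<close>)
  qed
  \<comment> \<open>The limit is computed unconditionally: the divergence term drops out because
    \<open>f a = 0\<close>, leaving \<open>- r * lie_deriv V f a\<close>. As \<open>r\<close> is
    nonzero, this is zero exactly in the case of tangency at \<open>a\<close>.\<close>
  have part1: "((\<lambda>x. branch_power l (r + 1) x * divergence W x) \<longlongrightarrow> 0) (F a)
      \<longleftrightarrow> lie_deriv V f a = 0" if a: "a \<in> \<Gamma>" for a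
  proof -
    have "((\<lambda>x. f x * divergence V x - r * lie_deriv V f x) \<longlongrightarrow>
        f a * divergence V a - r * lie_deriv V f a) (F a)"
      by (intro tendsto_intros F_lim[OF f_cont] div_lim lie_lim a_\<Omega>[OF a])
    then have "((\<lambda>x. complex_of_real (f x * divergence V x - r * lie_deriv V f x)) \<longlongrightarrow>
        of_real (- r * lie_deriv V f a)) (F a)"
      using fa[OF a] by (intro tendsto_of_real) simp
    moreover have "\<forall>\<^sub>F x in F a. of_real (f x * divergence V x - r * lie_deriv V f x) =
        branch_power l (r + 1) x * divergence W x"
      using F_ev by eventually_elim (simp only: eq_r1)
    ultimately have lim: "((\<lambda>x. branch_power l (r + 1) x * divergence W x) \<longlongrightarrow>
        of_real (- r * lie_deriv V f a)) (F a)"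
      by (rule Lim_transform_eventually)
    show ?thesis
    proof
      assume "((\<lambda>x. branch_power l (r + 1) x * divergence W x) \<longlongrightarrow> 0) (F a)"
      from tendsto_unique[OF F_ne[OF a] lim this] show "lie_deriv V f a = 0"
        using r by simp
    next
      assume "lie_deriv V f a = 0"
      with lim show "((\<lambda>x. branch_power l (r + 1) x * divergence W x) \<longlongrightarrow> 0) (F a)"
        by simp
    qed
  qed
  have part2: "first_integral_on \<Omega> V f"
    if hyp: "\<forall>x\<in>\<Omega> - \<Gamma>. branch_power l r x * divergence W x = of_real (divergence V x)"
    unfolding first_integral_on_def
  proof
    \<comment> \<open>Comparison with \<open>eq_r\<close> leaves only the Lie term, and
      \<open>r\<close> and \<open>f x\<close> are nonzero.\<close>
    have off: "lie_deriv V f x = 0" if "x \<in> \<Omega> - \<Gamma>" for x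
    proof -
      have "complex_of_real (divergence V x - r * lie_deriv V f x / f x) = of_real (divergence V x)"
        using eq_r[OF that] hyp that by simp
      then have "r * lie_deriv V f x / f x = 0"
        by (simp only: of_real_eq_iff)
      with r that \<Gamma> show ?thesis by auto
    qed
    fix x assume x: "x \<in> \<Omega>"
    show "lie_deriv V f x = 0"
    proof (cases "x \<in> \<Gamma>")
      case True
      \<comment> \<open>On \<Gamma> the value is recovered by continuity of the Lie derivative from
        the points off \<Gamma>.\<close>
      have "\<forall>\<^sub>F y in F x. lie_deriv V f y = 0"
        using F_ev by eventually_elim (rule off)
      then have "(lie_deriv V f \<longlongrightarrow> 0) (F x)"
        by (rule tendsto_eventually)
      then show ?thesis
        using tendsto_unique[OF F_ne[OF True] lie_lim[OF x]] by simp
    qed (use off x in auto)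
  qed
  \<comment> \<open>The same function tends to \<open>divergence V a\<close> by \<open>r_lim\<close>
    and to 0 by assumption, so uniqueness of limits decides.\<close>
  have part3: "divergence V a = 0"
    if "first_integral_on \<Omega> V f" "a \<in> \<Gamma>"
      "((\<lambda>x. branch_power l r x * divergence W x) \<longlongrightarrow> 0) (F a)" for a
    using tendsto_unique[OF F_ne[OF that(2)] r_lim[OF that(1) a_\<Omega>[OF that(2)]] that(3)] by simp
  have 1: "(\<forall>a\<in>\<Gamma>. ((\<lambda>x. branch_power l (r + 1) x * divergence W x) \<longlongrightarrow> 0) (F a))
      \<longleftrightarrow> invariant_zero_set \<Omega> V f"
    using part1 by (simp add: invariant_zero_set_def flip: \<Gamma>)
  have 2: "first_integral_on \<Omega> V f \<longleftrightarrow>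
      (\<forall>x\<in>\<Omega> - \<Gamma>. branch_power l r x * divergence W x = of_real (divergence V x)) \<and>
      (\<forall>a\<in>\<Gamma>. ((\<lambda>x. branch_power l r x * divergence W x)
                 \<longlongrightarrow> of_real (divergence V a)) (F a))"
    using part2 r_lim a_\<Omega> eq_r by (auto simp: first_integral_on_def)
  have 3: "first_integral_on \<Omega> V f \<and>
      (\<forall>a\<in>\<Gamma>. V a = 0 \<longrightarrow> (\<forall>i.
         ((\<lambda>x. branch_power l r x * divergence W x) \<longlongrightarrow> 0) (F a) \<and>
         ((\<lambda>x. branch_power l (r + 1) x * partial_deriv i (divergence W) x) \<longlongrightarrow> 0) (F a)))
      \<longrightarrow> (\<forall>a\<in>\<Gamma>. V a = 0 \<longrightarrow> divergence V a = 0)"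
    using part3 by simp
  show ?thesis
    by (intro conjI) (fact 1[unfolded F_def] 2[unfolded F_def] 3[unfolded F_def])+
qed

end
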